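(* Let $X$ be a reflexive Banach space (real or complex) of dimension larger than $1$ and let $T : X \to X$ be a bounded linear operator. Then $T$ has a non-trivial invariant subspace if and only if there exists a pair of bounded sequences $(x_n)_{n\in\mathbb{N}} \subset X$ and $(x_n^* )_{n\in\mathbb{N}} \subset X^*$ which are compatible (with respect to $T$).
   Context: $\mathbb{N}=\{1,2,3,\dots\}$. A closed linear subspace $Y$ of $X$ is an invariant subspace of $T$ if $T(Y)\subseteq Y$; it is non-trivial if $\{0\}\subsetneq Y\subsetneq X$. Definition (compatible sequences). Let $X$ be a Banach space and $T$ a bounded linear operator on $X$. Two bounded sequences $(x_n)_{n\in\mathbb{N}}\subset X$ and $(x_n^* )_{n\in\mathbb{N}}\subset X^*$ are called compatible if: (a) no subsequence of $(x_n)_n$ converges weakly to zero; (b) no subsequence of $(x_n^* )_n$ converges weakly to zero; (c) there exists a sequence $(\varepsilon_n)_n$ of positive numbers converging to zero such that $|x_m^*(T^k x_\ell)|<\varepsilon_m$ for all integers $1\le k\le \ell\le m$. *)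

theory Defs
  imports "HOL-Analysis.Analysis"
begin

text \<open>
  The library has no class of complex Banach spaces.  A Banach space over a scalar field
  \<open>'k\<close> (instantiated below only by \<open>real\<close> and \<open>complex\<close>) is therefore a type
  of class \<^class>\<open>banach\<close> together with a multiplication \<open>sc\<close> by scalars from \<open>'k\<close>
  that extends the real one.  For \<open>'k = real\<close> this forces \<open>sc = (*\<^sub>R)\<close>.
\<close>

definition normed_space_over :: "('k::real_normed_field \<Rightarrow> 'a::real_normed_vector \<Rightarrow> 'a) \<Rightarrow> bool" where
  "normed_space_over sc \<longleftrightarrow>
     vector_space sc \<and>
     (\<forall>r x. sc (of_real r) x = r *\<^sub>R x) \<and>
     (\<forall>c x. norm (sc c x) = norm c * norm x)"

text \<open>
  \<^const>\<open>vector_space.dim\<close> and \<^const>\<open>card\<close> are 0 in the infinite case, so the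
  dimension is expressed through a basis.
\<close>

definition dim_gt_one :: "('k::real_normed_field \<Rightarrow> 'a::real_normed_vector \<Rightarrow> 'a) \<Rightarrow> bool" where
  "dim_gt_one sc \<longleftrightarrow>
     (\<exists>B. \<not> module.dependent sc B \<and> module.span sc B = UNIV \<and> (infinite B \<or> 1 < card B))"

definition bounded_linear_over ::
    "('k::real_normed_field \<Rightarrow> 'a::real_normed_vector \<Rightarrow> 'a) \<Rightarrow> ('a \<Rightarrow> 'a) \<Rightarrow> bool" where
  "bounded_linear_over sc T \<longleftrightarrow> bounded_linear T \<and> (\<forall>c x. T (sc c x) = sc c (T x))"

text \<open>
  Bounded linear functionals on a linear subspace \<open>S\<close> of a normed space.  The carrier \<open>S\<close> is
  needed because the complex dual is not a whole type; values outside \<open>S\<close> are irrelevant.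
\<close>

definition bounded_functional_on ::
    "('k::real_normed_field \<Rightarrow> 'v::real_normed_vector \<Rightarrow> 'v) \<Rightarrow> 'v set \<Rightarrow> ('v \<Rightarrow> 'k) \<Rightarrow> bool" where
  "bounded_functional_on sc S \<phi> \<longleftrightarrow>
     (\<forall>x\<in>S. \<forall>y\<in>S. \<phi> (x + y) = \<phi> x + \<phi> y) \<and>
     (\<forall>c. \<forall>x\<in>S. \<phi> (sc c x) = c * \<phi> x) \<and>
     (\<exists>K. \<forall>x\<in>S. norm (\<phi> x) \<le> K * norm x)"

text \<open>
  The dual carries the operator norm of \<^typ>\<open>'a \<Rightarrow>\<^sub>L 'k\<close>; its scalar multiplication is
  \<open>(dual_scale c f) x = c * f x\<close>.
\<close>

definition dual ::
    "('k::real_normed_field \<Rightarrow> 'a::real_normed_vector \<Rightarrow> 'a) \<Rightarrow> ('a \<Rightarrow>\<^sub>L 'k) set" where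
  "dual sc = {f. bounded_functional_on sc UNIV (blinfun_apply f)}"

definition dual_scale ::
    "'k::real_normed_field \<Rightarrow> ('a::real_normed_vector \<Rightarrow>\<^sub>L 'k) \<Rightarrow> ('a \<Rightarrow>\<^sub>L 'k)" where
  "dual_scale c f = blinfun_mult_right c o\<^sub>L f"

text \<open>Surjectivity of the canonical embedding into the bidual.\<close>

definition reflexive :: "('k::real_normed_field \<Rightarrow> 'a::real_normed_vector \<Rightarrow> 'a) \<Rightarrow> bool" where
  "reflexive sc \<longleftrightarrow>
     (\<forall>\<phi>. bounded_functional_on dual_scale (dual sc) \<phi> \<longrightarrow>
          (\<exists>x. \<forall>f\<in>dual sc. \<phi> f = blinfun_apply f x))"

definition weakly_tendsto_on ::
    "('k::real_normed_field \<Rightarrow> 'v::real_normed_vector \<Rightarrow> 'v) \<Rightarrow> 'v set \<Rightarrow> (nat \<Rightarrow> 'v) \<Rightarrow> 'v \<Rightarrow> bool" where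
  "weakly_tendsto_on sc S x l \<longleftrightarrow>
     (\<forall>\<phi>. bounded_functional_on sc S \<phi> \<longrightarrow> (\<lambda>n. \<phi> (x n)) \<longlonglongrightarrow> \<phi> l)"

definition invariant_subspace ::
    "('k::real_normed_field \<Rightarrow> 'a::real_normed_vector \<Rightarrow> 'a) \<Rightarrow> ('a \<Rightarrow> 'a) \<Rightarrow> 'a set \<Rightarrow> bool" where
  "invariant_subspace sc T Y \<longleftrightarrow> module.subspace sc Y \<and> closed Y \<and> T ` Y \<subseteq> Y"

definition has_nontrivial_invariant_subspace ::
    "('k::real_normed_field \<Rightarrow> 'a::real_normed_vector \<Rightarrow> 'a) \<Rightarrow> ('a \<Rightarrow> 'a) \<Rightarrow> bool" where
  "has_nontrivial_invariant_subspace sc T \<longleftrightarrow>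
     (\<exists>Y. invariant_subspace sc T Y \<and> {0} \<subset> Y \<and> Y \<subset> UNIV)"

text \<open>
  Sequences are indexed by the positive integers: the values at index 0 are never used.
  A subsequence is given by a strictly increasing sequence \<open>r\<close> of positive indices.
\<close>

definition no_weakly_null_subseq_on ::
    "('k::real_normed_field \<Rightarrow> 'v::real_normed_vector \<Rightarrow> 'v) \<Rightarrow> 'v set \<Rightarrow> (nat \<Rightarrow> 'v) \<Rightarrow> bool" where
  "no_weakly_null_subseq_on sc S x \<longleftrightarrow>
     \<not> (\<exists>r::nat \<Rightarrow> nat. strict_mono r \<and> (\<forall>j. 1 \<le> r j) \<and> weakly_tendsto_on sc S (x \<circ> r) 0)"

definition compatible ::
    "('k::real_normed_field \<Rightarrow> 'a::real_normed_vector \<Rightarrow> 'a) \<Rightarrow> ('a \<Rightarrow> 'a) \<Rightarrow>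
     (nat \<Rightarrow> 'a) \<Rightarrow> (nat \<Rightarrow> 'a \<Rightarrow>\<^sub>L 'k) \<Rightarrow> bool" where
  "compatible sc T x xs \<longleftrightarrow>
     bounded (x ` {1..}) \<and>
     xs ` {1..} \<subseteq> dual sc \<and> bounded (xs ` {1..}) \<and>
     no_weakly_null_subseq_on sc UNIV x \<and>
     no_weakly_null_subseq_on dual_scale (dual sc) xs \<and>
     (\<exists>\<epsilon>::nat \<Rightarrow> real. (\<forall>n\<ge>1. 0 < \<epsilon> n) \<and> \<epsilon> \<longlonglongrightarrow> 0 \<and>
        (\<forall>k l m. 1 \<le> k \<and> k \<le> l \<and> l \<le> m \<longrightarrow>
           norm (blinfun_apply (xs m) ((T ^^ k) (x l))) < \<epsilon> m))"

text \<open>For real scalars these notions are the library's.\<close>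

lemma bounded_linear_over_scaleR: "bounded_linear_over (*\<^sub>R) T \<longleftrightarrow> bounded_linear T"
  by (auto simp: bounded_linear_over_def linear_simps)

lemma dual_scaleR: "dual ((*\<^sub>R) :: real \<Rightarrow> 'a::real_normed_vector \<Rightarrow> 'a) = UNIV"
proof -
  have "bounded_functional_on (*\<^sub>R) UNIV (blinfun_apply f)" for f :: "'a \<Rightarrow>\<^sub>L real"
    unfolding bounded_functional_on_def
    by (auto simp: blinfun.add_right blinfun.scaleR_right intro!: exI[of _ "norm f"] norm_blinfun[of f, simplified])
  then show ?thesis by (auto simp: dual_def)
qed

lemma dual_scale_real: "dual_scale = ((*\<^sub>R) :: real \<Rightarrow> ('a::real_normed_vector \<Rightarrow>\<^sub>L real) \<Rightarrow> _)"
  by (intro ext blinfun_eqI) (simp add: dual_scale_def blinfun.scaleR_left)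

lemma normed_space_over_real: "normed_space_over sc \<longleftrightarrow> sc = (*\<^sub>R)"
proof
  assume "normed_space_over sc"
  then show "sc = (*\<^sub>R)" by (auto simp: normed_space_over_def fun_eq_iff)
next
  assume "sc = (*\<^sub>R)"
  then show "normed_space_over sc"
    by (simp add: normed_space_over_def real_vector.vector_space_axioms)
qed

end

theory Submission
  imports Defs
begin

text \<open>
  If \<open>Y\<close> is a non-trivial invariant subspace, the constant sequences \<open>y \<in> Y - {0}\<close> and \<open>f\<close>, with
  \<open>f \<noteq> 0\<close> a functional vanishing on \<open>Y\<close>, are compatible, because \<open>f (T\<^sup>k y) = 0\<close> for all \<open>k\<close>.

  For the converse one wants nonzero weak limits \<open>x\<^sub>0\<close> of \<open>x\<close> and \<open>f\<close> of \<open>xs\<close>.  Weak sequential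
  compactness can be bypassed.  If \<open>A\<^sub>n\<close> are uniformly bounded functionals on a space, then
  \<open>v \<mapsto> limsup \<bar>A\<^sub>n v\<bar>\<close> is a seminorm, and when some \<open>A\<^sub>n v\<close> does not tend to 0 the Hahn-Banach
  theorem produces a nonzero functional dominated by it, which hence vanishes at each \<open>v\<close> with
  \<open>A\<^sub>n v \<longlonglongrightarrow> 0\<close> (lemma \<open>generalized_limit\<close>).  With \<open>A\<^sub>n\<close> the evaluation at \<open>x\<^sub>n\<close> on the dual,
  reflexivity turns this functional into a vector \<open>x\<^sub>0\<close>; with \<open>A\<^sub>n = xs\<^sub>n\<close> it is \<open>f\<close>.
  Compatibility gives \<open>xs\<^sub>m (T\<^sup>k x\<^sub>l) \<longlonglongrightarrow> 0\<close> as \<open>m \<rightarrow> \<infinity>\<close>, so \<open>f (T\<^sup>k x\<^sub>l) = 0\<close> for \<open>l \<ge> k \<ge> 1\<close>, so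
  \<open>f (T\<^sup>k x\<^sub>0) = 0\<close> for \<open>k \<ge> 1\<close>.  If \<open>T x\<^sub>0 \<noteq> 0\<close>, the common kernel of all \<open>f \<circ> T\<^sup>k\<close>, \<open>k \<ge> 0\<close>, is a
  non-trivial invariant subspace, as it contains \<open>T x\<^sub>0\<close> and lies in \<open>ker f\<close>.  If \<open>T x\<^sub>0 = 0\<close>, then \<open>ker T\<close> is one
  unless \<open>T = 0\<close>, in which case \<open>ker f\<close> is one, since the dimension exceeds 1.

  The Hahn-Banach theorem is the only step that depends on the scalar field.  The argument is
  therefore carried out over any field for which it holds (predicate \<open>hahn_banach\<close>), once it is
  established for \<open>real\<close> and \<open>complex\<close>.
\<close>

section \<open>The Hahn-Banach theorem\<close>

definition sublinear :: "('v::real_vector \<Rightarrow> real) \<Rightarrow> bool" where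
  "sublinear p \<longleftrightarrow> (\<forall>x y. p (x + y) \<le> p x + p y) \<and> (\<forall>t\<ge>0. \<forall>x. p (t *\<^sub>R x) = t * p x)"

lemma sublinear_zero: "sublinear p \<Longrightarrow> p 0 = 0"
  unfolding sublinear_def by (metis mult_zero_left order_refl scaleR_zero_left)

lemma sublinear_ge: "sublinear p \<Longrightarrow> - p (- x) \<le> p x"
  using sublinear_zero[of p] unfolding sublinear_def
  by (metis add.right_inverse add_0 add_le_cancel_right ab_left_minus)

text \<open>
  Positive homogeneity only needs one inequality for positive scalars: the other follows by
  scaling with the inverse.
\<close>

lemma sublinearI:
  assumes "\<And>x y. p (x + y) \<le> p x + p y" "p 0 = 0" "\<And>t x. 0 < t \<Longrightarrow> p (t *\<^sub>R x) \<le> t * p x"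
  shows "sublinear p"
proof -
  have "p (t *\<^sub>R x) = t * p x" if "0 \<le> t" for t x
  proof (cases "t = 0")
    case False
    then have t: "0 < t" using that by simp
    have "p (inverse t *\<^sub>R (t *\<^sub>R x)) \<le> inverse t * p (t *\<^sub>R x)"
      using t by (intro assms(3)) simp
    then have "t * p x \<le> p (t *\<^sub>R x)"
      using t by (simp add: field_simps)
    then show ?thesis using assms(3)[OF t, of x] by simp
  qed (simp add: assms(2))
  then show ?thesis using assms(1) by (simp add: sublinear_def)
qed

text \<open>
  The infimum of \<open>p (x + t *\<^sub>R v) - t * p v\<close> over \<open>t \<ge> 0\<close> is again sublinear, and every linear
  minorant of it takes the value \<open>p v\<close> at \<open>v\<close>.  The construction has two uses: a minimal
  sublinear function is unchanged by it, hence odd and so linear; and applied to a given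
  seminorm it makes the linear minorant nonzero at one prescribed vector.
\<close>

lemma sublinear_slide:
  fixes p :: "'v::real_vector \<Rightarrow> real"
  assumes p: "sublinear p"
  obtains q where "sublinear q" "\<And>x. q x \<le> p x" "q (- v) \<le> - p v"
proof -
  have padd: "p (x + y) \<le> p x + p y" for x y
    using p by (auto simp: sublinear_def)
  have psc: "0 \<le> t \<Longrightarrow> p (t *\<^sub>R x) = t * p x" for t x
    using p by (auto simp: sublinear_def)
  define S where "S x = (\<lambda>t. p (x + t *\<^sub>R v) - t * p v) ` {0..}" for x
  define q where "q x = Inf (S x)" for x
  have low: "- p (- x) \<le> p (x + t *\<^sub>R v) - t * p v" if "0 \<le> t" for x t
    using padd[of "x + t *\<^sub>R v" "- x"] psc[OF that, of v] by simp
  have bdd: "bdd_below (S x)" for x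
    unfolding S_def by (rule bdd_belowI2[of _ "- p (- x)"]) (use low in auto)
  have qle: "q x \<le> p (x + t *\<^sub>R v) - t * p v" if "0 \<le> t" for x t
    unfolding q_def by (rule cInf_lower[OF _ bdd]) (use that in \<open>auto simp: S_def\<close>)
  have qge: "c \<le> q x" if "\<And>t. 0 \<le> t \<Longrightarrow> c \<le> p (x + t *\<^sub>R v) - t * p v" for c x
    unfolding q_def by (rule cInf_greatest) (use that in \<open>auto simp: S_def\<close>)
  have "sublinear q"
  proof (rule sublinearI)
    fix x y
    have *: "q (x + y) \<le> (p (x + s *\<^sub>R v) - s * p v) + (p (y + t *\<^sub>R v) - t * p v)"
      if "0 \<le> s" "0 \<le> t" for s t
      using qle[of "s + t" "x + y"] that padd[of "x + s *\<^sub>R v" "y + t *\<^sub>R v"]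
      by (simp add: algebra_simps)
    have "q (x + y) - (p (y + t *\<^sub>R v) - t * p v) \<le> q x" if "0 \<le> t" for t
      by (rule qge) (use *[OF _ that] in \<open>simp add: algebra_simps\<close>)
    then have "q (x + y) - q x \<le> q y"
      by (intro qge) (simp add: algebra_simps)
    then show "q (x + y) \<le> q x + q y" by simp
  next
    have "q 0 \<le> 0" using qle[of 0 0] sublinear_zero[OF p] by simp
    moreover have "0 \<le> q 0" by (rule qge) (simp add: psc)
    ultimately show "q 0 = 0" by simp
  next
    fix t :: real and x assume t: "0 < t"
    have "q (t *\<^sub>R x) / t \<le> q x"
    proof (rule qge)
      fix s :: real assume s: "0 \<le> s"
      have "q (t *\<^sub>R x) \<le> p (t *\<^sub>R (x + s *\<^sub>R v)) - (t * s) * p v"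
        using qle[of "t * s" "t *\<^sub>R x"] s t by (simp add: algebra_simps)
      also have "\<dots> = t * (p (x + s *\<^sub>R v) - s * p v)"
        using t psc[of t "x + s *\<^sub>R v"] by (simp add: right_diff_distrib)
      finally show "q (t *\<^sub>R x) / t \<le> p (x + s *\<^sub>R v) - s * p v"
        using t by (simp add: field_simps)
    qed
    then show "q (t *\<^sub>R x) \<le> t * q x" using t by (simp add: field_simps)
  qed
  moreover have "q x \<le> p x" for x using qle[of 0 x] by simp
  moreover have "q (- v) \<le> - p v" using qle[of 1 "- v"] sublinear_zero[OF p] by simp
  ultimately show thesis by (rule that)
qed

text \<open>
  In \<open>u (x + y) \<le> q x + r y\<close> the members \<open>q\<close> and \<open>r\<close> of the chain can be replaced by the smaller of
  the two, which is subadditive; the bound \<open>p\<close> keeps the infima finite.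
\<close>

lemma sublinear_Inf_chain:
  fixes C :: "('v::real_vector \<Rightarrow> real) set"
  assumes ne: "C \<noteq> {}" and sub: "\<And>q. q \<in> C \<Longrightarrow> sublinear q"
    and le: "\<And>q x. q \<in> C \<Longrightarrow> q x \<le> p x"
    and chain: "\<And>q r. q \<in> C \<Longrightarrow> r \<in> C \<Longrightarrow> q \<le> r \<or> r \<le> q"
  obtains u where "sublinear u" "\<And>q. q \<in> C \<Longrightarrow> u \<le> q"
proof -
  define u where "u x = (INF q\<in>C. q x)" for x
  have bdd: "bdd_below ((\<lambda>q. q x) ` C)" for x
  proof (rule bdd_belowI2[of _ "- p (- x)"])
    fix q assume "q \<in> C"
    then show "- p (- x) \<le> q x" using sublinear_ge[OF sub, of q x] le[of q "- x"] by simp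
  qed
  have ule: "u x \<le> q x" if "q \<in> C" for q x
    unfolding u_def by (rule cINF_lower[OF bdd that])
  have uge: "c \<le> u x" if "\<And>q. q \<in> C \<Longrightarrow> c \<le> q x" for c x
    unfolding u_def by (rule cINF_greatest[OF ne that])
  have "sublinear u"
  proof (rule sublinearI)
    fix x y
    have *: "u (x + y) \<le> q x + r y" if qr: "q \<in> C" "r \<in> C" for q r
    proof -
      obtain s where s: "s \<in> C" "s \<le> q" "s \<le> r" using chain[OF qr] qr by blast
      have "u (x + y) \<le> s (x + y)" by (rule ule[OF s(1)])
      also have "\<dots> \<le> s x + s y" using sub[OF s(1)] by (simp add: sublinear_def)
      also have "\<dots> \<le> q x + r y" using s by (intro add_mono) (auto simp: le_fun_def)
      finally show ?thesis .
    qed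
    have "u (x + y) - r y \<le> u x" if "r \<in> C" for r
      by (rule uge) (use *[OF _ that] in \<open>simp add: algebra_simps\<close>)
    then have "u (x + y) - u x \<le> u y"
      by (intro uge) (simp add: algebra_simps)
    then show "u (x + y) \<le> u x + u y" by simp
  next
    show "u 0 = 0" unfolding u_def using ne by (simp add: sub sublinear_zero)
  next
    fix t :: real and x assume t: "0 < t"
    have "u (t *\<^sub>R x) / t \<le> u x"
    proof (rule uge)
      fix q assume q: "q \<in> C"
      have "u (t *\<^sub>R x) \<le> t * q x"
        using ule[OF q, of "t *\<^sub>R x"] sub[OF q] t by (simp add: sublinear_def)
      then show "u (t *\<^sub>R x) / t \<le> q x" using t by (simp add: field_simps)
    qed
    then show "u (t *\<^sub>R x) \<le> t * u x" using t by (simp add: field_simps)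
  qed
  then show thesis by (rule that) (simp add: le_fun_def ule)
qed

text \<open>By Zorn's lemma there is a minimal sublinear function below \<open>p\<close>, and it is linear.\<close>

lemma linear_minorant:
  fixes p :: "'v::real_vector \<Rightarrow> real"
  assumes p: "sublinear p"
  obtains u where "linear u" "\<And>x. u x \<le> p x"
proof -
  define A where "A = {q. sublinear q \<and> q \<le> p}"
  have "\<exists>m\<in>A. \<forall>a\<in>A. a \<le> m \<longrightarrow> a = m"
  proof (rule predicate_Zorn)
    show "partial_order_on A (relation_of (\<lambda>a b. b \<le> a) A)"
      by (rule partial_order_on_relation_ofI) auto
  next
    fix C assume C: "C \<in> Chains (relation_of (\<lambda>a b. b \<le> a) A)"
    then have CA: "C \<subseteq> A" and ch: "\<And>q r. q \<in> C \<Longrightarrow> r \<in> C \<Longrightarrow> q \<le> r \<or> r \<le> q"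
      by (auto simp: Chains_def relation_of_def)
    show "\<exists>u\<in>A. \<forall>a\<in>C. u \<le> a"
    proof (cases "C = {}")
      case True
      then show ?thesis using p by (auto simp: A_def)
    next
      case False
      have sub: "\<And>q. q \<in> C \<Longrightarrow> sublinear q" and le: "\<And>q x. q \<in> C \<Longrightarrow> q x \<le> p x"
        using CA by (auto simp: A_def le_fun_def)
      obtain u where u: "sublinear u" "\<And>q. q \<in> C \<Longrightarrow> u \<le> q"
        using sublinear_Inf_chain[where C = C and p = p] False sub le ch by blast
      obtain q where q: "q \<in> C" using False by blast
      have "u \<le> p" using u(2)[OF q] q CA by (auto simp: A_def)
      then show ?thesis using u by (auto simp: A_def)
    qed
  qed
  then obtain m where m: "sublinear m" "m \<le> p"
    and min: "\<And>a. sublinear a \<Longrightarrow> a \<le> p \<Longrightarrow> a \<le> m \<Longrightarrow> a = m"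
    unfolding A_def by blast
  have odd: "m (- v) = - m v" for v
  proof -
    obtain q where q: "sublinear q" "\<And>x. q x \<le> m x" "q (- v) \<le> - m v"
      using sublinear_slide[OF m(1)] by blast
    then have "q \<le> m" by (simp add: le_fun_def)
    then have "q = m" using min[OF q(1)] m(2) by (simp add: order_trans)
    then show ?thesis using q(3) sublinear_ge[OF m(1), of "- v"] by simp
  qed
  have madd: "m (x + y) \<le> m x + m y" for x y
    using m(1) by (simp add: sublinear_def)
  have mpos: "0 \<le> t \<Longrightarrow> m (t *\<^sub>R x) = t * m x" for t x
    using m(1) by (simp add: sublinear_def)
  have "linear m"
  proof (rule linearI)
    fix x y
    show "m (x + y) = m x + m y"
      using madd[of x y] madd[of "x + y" "- y"] odd[of y] by simp
  next
    fix r :: real and x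
    show "m (r *\<^sub>R x) = r *\<^sub>R m x"
    proof (cases "0 \<le> r")
      case False
      then show ?thesis using mpos[of "- r" x] odd[of "r *\<^sub>R x"] by simp
    qed (simp add: mpos)
  qed
  then show thesis using that m(2) by (auto simp: le_fun_def)
qed

definition seminorm_over :: "('k::real_normed_field \<Rightarrow> 'v::real_vector \<Rightarrow> 'v) \<Rightarrow> ('v \<Rightarrow> real) \<Rightarrow> bool" where
  "seminorm_over sc p \<longleftrightarrow>
     (\<forall>x y. p (x + y) \<le> p x + p y) \<and> (\<forall>c x. p (sc c x) \<le> norm c * p x)"

definition linear_form :: "('k::real_normed_field \<Rightarrow> 'v::real_vector \<Rightarrow> 'v) \<Rightarrow> ('v \<Rightarrow> 'k) \<Rightarrow> bool" where
  "linear_form sc \<phi> \<longleftrightarrow> (\<forall>x y. \<phi> (x + y) = \<phi> x + \<phi> y) \<and> (\<forall>c x. \<phi> (sc c x) = c * \<phi> x)"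

definition hahn_banach :: "('k::real_normed_field \<Rightarrow> 'v::real_vector \<Rightarrow> 'v) \<Rightarrow> bool" where
  "hahn_banach sc \<longleftrightarrow>
     (\<forall>p v. seminorm_over sc p \<and> p v \<noteq> 0 \<longrightarrow>
        (\<exists>\<phi>. linear_form sc \<phi> \<and> (\<forall>x. norm (\<phi> x) \<le> p x) \<and> \<phi> v \<noteq> 0))"

lemma seminorm_real_minorant:
  fixes p :: "'v::real_vector \<Rightarrow> real"
  assumes p: "seminorm_over (*\<^sub>R) p" and v: "p v \<noteq> 0"
  obtains u where "linear u" "\<And>x. u x \<le> p x" "0 < u v"
proof -
  have padd: "p (x + y) \<le> p x + p y" and psc: "p (r *\<^sub>R x) \<le> \<bar>r\<bar> * p x" for x y r
    using p by (auto simp: seminorm_over_def)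
  have p0: "p 0 = 0" using psc[of 0 0] padd[of 0 0] by simp
  then have "0 \<le> p v" using padd[of v "- v"] psc[of "-1" v] by simp
  then have pv: "0 < p v" using v by simp
  have "sublinear p"
    by (rule sublinearI) (use padd psc p0 in \<open>auto intro: order_trans[OF psc]\<close>)
  then obtain q where q: "sublinear q" "\<And>x. q x \<le> p x" "q (- v) \<le> - p v"
    using sublinear_slide by blast
  obtain u where u: "linear u" "\<And>x. u x \<le> q x"
    using linear_minorant[OF q(1)] by blast
  have "u (- v) = - u v" using u(1) by (rule linear_neg)
  then have "0 < u v" using u(2)[of "- v"] q(3) pv by simp
  with u(1) show thesis using that u(2) q(2) by (meson order_trans)
qed

lemma hahn_banach_real: "hahn_banach ((*\<^sub>R) :: real \<Rightarrow> 'v::real_vector \<Rightarrow> 'v)"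
  unfolding hahn_banach_def
proof (intro allI impI, elim conjE)
  fix p :: "'v \<Rightarrow> real" and v
  assume p: "seminorm_over (*\<^sub>R) p" and v: "p v \<noteq> 0"
  obtain u where u: "linear u" "\<And>x. u x \<le> p x" "0 < u v"
    using seminorm_real_minorant[OF p v] by blast
  have "\<bar>u x\<bar> \<le> p x" for x
  proof -
    have "- u x = u (- x)" using u(1) by (simp add: linear_neg)
    also have "\<dots> \<le> p (- x)" by (rule u(2))
    also have "\<dots> \<le> p x" using p unfolding seminorm_over_def
      by (metis abs_1 abs_minus_cancel mult_1 real_norm_def scaleR_minus1_left)
    finally show ?thesis using u(2)[of x] by simp
  qed
  moreover have "linear_form (*\<^sub>R) u"
    using u(1) by (simp add: linear_form_def linear_add linear_cmul)
  ultimately show "\<exists>\<phi>. linear_form (*\<^sub>R) \<phi> \<and> (\<forall>x. norm (\<phi> x) \<le> p x) \<and> \<phi> v \<noteq> 0"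
    using u(3) by (intro exI[of _ u]) auto
qed

text \<open>
  A complex functional is determined by its real part \<open>u\<close> through \<open>\<phi> x = u x - \<i> u (\<i> x)\<close>, and
  rotating \<open>\<phi> x\<close> onto the positive axis bounds its modulus by the bound on \<open>u\<close>.
\<close>

lemma hahn_banach_complex:
  fixes sc :: "complex \<Rightarrow> 'v::real_vector \<Rightarrow> 'v"
  assumes vs: "vector_space sc" and real: "\<And>r x. sc (of_real r) x = r *\<^sub>R x"
  shows "hahn_banach sc"
  unfolding hahn_banach_def
proof (intro allI impI, elim conjE)
  fix p :: "'v \<Rightarrow> real" and v
  assume p: "seminorm_over sc p" and v: "p v \<noteq> 0"
  interpret vector_space sc by (rule vs)
  have psc: "p (sc c x) \<le> norm c * p x" for c x
    using p by (simp add: seminorm_over_def)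
  have "p (r *\<^sub>R x) \<le> \<bar>r\<bar> * p x" for r x
    using psc[of "of_real r" x] by (simp add: real)
  then have "seminorm_over (*\<^sub>R) p"
    using p by (simp add: seminorm_over_def)
  then obtain u where u: "linear u" "\<And>x. u x \<le> p x" "0 < u v"
    using seminorm_real_minorant[of p v] v by blast
  define \<phi> where "\<phi> x = Complex (u x) (- u (sc \<i> x))" for x
  have uadd: "u (x + y) = u x + u y" and uneg: "u (- x) = - u x"
    and usc: "u (sc (of_real r) x) = r * u x" for x y r
    using u(1) by (simp_all add: linear_add linear_neg linear_cmul real)
  have usc': "u (sc c x) = Re c * u x + Im c * u (sc \<i> x)" for c x
  proof -
    have "sc c x = sc (of_real (Re c)) x + sc (of_real (Im c)) (sc \<i> x)"
      by (simp add: scale_left_distrib[symmetric] complex_eq[symmetric] mult.commute)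
    then have "u (sc c x) = u (sc (of_real (Re c)) x) + u (sc (of_real (Im c)) (sc \<i> x))"
      by (simp only: uadd)
    then show ?thesis by (simp only: usc)
  qed
  have \<phi>sc: "\<phi> (sc c x) = c * \<phi> x" for c x
  proof -
    have "u (sc \<i> (sc c x)) = - Im c * u x + Re c * u (sc \<i> x)"
      using usc'[of "\<i> * c" x] by simp
    then show ?thesis by (simp add: \<phi>_def complex_eq_iff usc'[of c x])
  qed
  have lin: "linear_form sc \<phi>"
    by (simp add: linear_form_def \<phi>sc) (simp add: \<phi>_def uadd scale_right_distrib complex_eq_iff)
  have "norm (\<phi> x) \<le> p x" for x
  proof -
    obtain c where c: "norm c = 1" "c * \<phi> x = of_real (norm (\<phi> x))"
    proof (cases "\<phi> x = 0")
      case False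
      have "cnj (\<phi> x) / of_real (norm (\<phi> x)) * \<phi> x = of_real (norm (\<phi> x))"
        using False complex_norm_square[of "\<phi> x"]
        by (simp add: field_simps power2_eq_square)
      then show thesis using False
        by (intro that[of "cnj (\<phi> x) / of_real (norm (\<phi> x))"]) (simp_all add: norm_divide)
    qed (use that[of 1] in simp)
    have "norm (\<phi> x) = Re (\<phi> (sc c x))" using c(2) by (simp add: \<phi>sc)
    also have "\<dots> = u (sc c x)" by (simp add: \<phi>_def)
    also have "\<dots> \<le> p (sc c x)" by (rule u(2))
    also have "\<dots> \<le> p x" using psc[of c x] c(1) by simp
    finally show ?thesis .
  qed
  moreover have "\<phi> v \<noteq> 0" using u(3) by (simp add: \<phi>_def complex_eq_iff)
  ultimately show "\<exists>\<phi>. linear_form sc \<phi> \<and> (\<forall>x. norm (\<phi> x) \<le> p x) \<and> \<phi> v \<noteq> 0"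
    using lin by blast
qed

section \<open>The limsup seminorm\<close>

text \<open>This is the real-valued \<open>limsup\<close> of the norms, for a bounded sequence.\<close>

definition limsup_norm :: "(nat \<Rightarrow> 'k::real_normed_vector) \<Rightarrow> real" where
  "limsup_norm s = Inf {c. \<forall>\<^sub>F n in sequentially. norm (s n) \<le> c}"

lemma limsup_norm_le:
  assumes "\<forall>\<^sub>F n in sequentially. norm (s n) \<le> c"
  shows "limsup_norm s \<le> c"
  unfolding limsup_norm_def
proof (rule cInf_lower)
  show "bdd_below {c. \<forall>\<^sub>F n in sequentially. norm (s n) \<le> c}"
  proof (rule bdd_belowI[of _ 0])
    fix d assume "d \<in> {c. \<forall>\<^sub>F n in sequentially. norm (s n) \<le> c}"
    then obtain n where "norm (s n) \<le> d"
      using eventually_happens[of _ sequentially] by auto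
    then show "0 \<le> d" using norm_ge_zero[of "s n"] by linarith
  qed
qed (use assms in simp)

lemma limsup_norm_less:
  assumes "Bseq s" and "limsup_norm s < c"
  shows "\<forall>\<^sub>F n in sequentially. norm (s n) \<le> c"
proof -
  obtain K where "\<And>n. norm (s n) \<le> K" using assms(1) by (auto simp: Bseq_def)
  then have "K \<in> {c. \<forall>\<^sub>F n in sequentially. norm (s n) \<le> c}" by simp
  then have ne: "{c. \<forall>\<^sub>F n in sequentially. norm (s n) \<le> c} \<noteq> {}" by blast
  obtain d where "\<forall>\<^sub>F n in sequentially. norm (s n) \<le> d" "d < c"
    using cInf_lessD[OF ne assms(2)[unfolded limsup_norm_def]] by auto
  then show ?thesis by (auto elim!: eventually_mono)
qed

lemma limsup_norm_nonneg:
  assumes "Bseq s"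
  shows "0 \<le> limsup_norm s"
proof (rule ccontr)
  assume "\<not> 0 \<le> limsup_norm s"
  then have "\<forall>\<^sub>F n in sequentially. norm (s n) \<le> limsup_norm s / 2"
    by (intro limsup_norm_less[OF assms]) simp
  then obtain n where "norm (s n) \<le> limsup_norm s / 2"
    using eventually_happens[of _ sequentially] by auto
  then show False using \<open>\<not> 0 \<le> limsup_norm s\<close> norm_ge_zero[of "s n"] by linarith
qed

lemma limsup_norm_eq_0_iff:
  assumes "Bseq s"
  shows "limsup_norm s = 0 \<longleftrightarrow> s \<longlonglongrightarrow> 0"
proof
  assume "limsup_norm s = 0"
  then have ev: "\<forall>\<^sub>F n in sequentially. norm (s n) \<le> e / 2" if "0 < e" for e
    using limsup_norm_less[OF assms, of "e / 2"] that by simp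
  show "s \<longlonglongrightarrow> 0"
  proof (rule tendstoI)
    fix e :: real assume "0 < e"
    then show "\<forall>\<^sub>F n in sequentially. dist (s n) 0 < e"
      using ev[of e] by (auto elim!: eventually_mono)
  qed
next
  assume lim: "s \<longlonglongrightarrow> 0"
  have "limsup_norm s \<le> e" if "0 < e" for e
  proof (rule limsup_norm_le)
    show "\<forall>\<^sub>F n in sequentially. norm (s n) \<le> e"
      using tendstoD[OF lim that] by (auto elim!: eventually_mono)
  qed
  then have "limsup_norm s \<le> 0" using field_le_epsilon[of "limsup_norm s" 0] by simp
  then show "limsup_norm s = 0" using limsup_norm_nonneg[OF assms] by simp
qed

lemma limsup_norm_add:
  assumes "Bseq s" "Bseq t"
  shows "limsup_norm (\<lambda>n. s n + t n) \<le> limsup_norm s + limsup_norm t"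
proof (rule field_le_epsilon)
  fix e :: real assume "0 < e"
  then have "\<forall>\<^sub>F n in sequentially. norm (s n) \<le> limsup_norm s + e / 2"
    "\<forall>\<^sub>F n in sequentially. norm (t n) \<le> limsup_norm t + e / 2"
    using assms by (auto intro!: limsup_norm_less)
  then have "\<forall>\<^sub>F n in sequentially. norm (s n + t n) \<le> limsup_norm s + limsup_norm t + e"
    by eventually_elim (rule norm_triangle_le, simp)
  then show "limsup_norm (\<lambda>n. s n + t n) \<le> limsup_norm s + limsup_norm t + e"
    by (rule limsup_norm_le)
qed

lemma limsup_norm_mult:
  fixes s :: "nat \<Rightarrow> 'k::real_normed_field"
  assumes "Bseq s"
  shows "limsup_norm (\<lambda>n. c * s n) \<le> norm c * limsup_norm s"
proof (cases "c = 0")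
  case True
  then show ?thesis by (auto intro!: limsup_norm_le)
next
  case False
  show ?thesis
  proof (rule field_le_epsilon)
    fix e :: real assume e: "0 < e"
    have "\<forall>\<^sub>F n in sequentially. norm (s n) \<le> limsup_norm s + e / norm c"
      using e False by (intro limsup_norm_less[OF assms]) simp
    then have "\<forall>\<^sub>F n in sequentially. norm (c * s n) \<le> norm c * limsup_norm s + e"
      by eventually_elim (use False in \<open>simp add: norm_mult field_simps\<close>)
    then show "limsup_norm (\<lambda>n. c * s n) \<le> norm c * limsup_norm s + e"
      by (rule limsup_norm_le)
  qed
qed

text \<open>
  The functional obtained here stands in for a limit of the \<open>A n\<close> along an ultrafilter that
  witnesses \<open>A n v \<longlongrightarrow> 0\<close> failing.
\<close>

lemma generalized_limit:
  fixes sc :: "'k::real_normed_field \<Rightarrow> 'v::real_normed_vector \<Rightarrow> 'v"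
  assumes hb: "hahn_banach sc"
    and A: "\<And>n. linear_form sc (A n)" and K: "\<And>n v. norm (A n v) \<le> K * norm v"
    and v: "\<not> (\<lambda>n. A n v) \<longlonglongrightarrow> 0"
  obtains \<phi> where "linear_form sc \<phi>" "\<And>v. norm (\<phi> v) \<le> K * norm v" "\<phi> v \<noteq> 0"
    "\<And>w. (\<lambda>n. A n w) \<longlonglongrightarrow> 0 \<Longrightarrow> \<phi> w = 0"
proof -
  define p where "p w = limsup_norm (\<lambda>n. A n w)" for w
  have B: "Bseq (\<lambda>n. A n w)" for w
    using K by (intro BseqI'[of _ "K * norm w"])
  have "p (w + z) \<le> p w + p z" for w z
    using limsup_norm_add[OF B B, of w z] A by (simp add: p_def linear_form_def)
  moreover have "p (sc c w) \<le> norm c * p w" for c w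
    using limsup_norm_mult[OF B, of c w] A by (simp add: p_def linear_form_def)
  ultimately have "seminorm_over sc p" by (simp add: seminorm_over_def)
  moreover have "p v \<noteq> 0" using v limsup_norm_eq_0_iff[OF B] by (simp add: p_def)
  ultimately obtain \<phi> where \<phi>: "linear_form sc \<phi>" "\<And>w. norm (\<phi> w) \<le> p w" "\<phi> v \<noteq> 0"
    using hb unfolding hahn_banach_def by meson
  show thesis
  proof
    fix w
    have "p w \<le> K * norm w" unfolding p_def using K by (auto intro!: limsup_norm_le)
    then show "norm (\<phi> w) \<le> K * norm w" using \<phi>(2)[of w] by simp
    assume "(\<lambda>n. A n w) \<longlonglongrightarrow> 0"
    then have "p w = 0" using limsup_norm_eq_0_iff[OF B] by (simp add: p_def)
    then show "\<phi> w = 0" using \<phi>(2)[of w] by simp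
  qed (use \<phi> in auto)
qed

section \<open>Functionals on a normed space over a field\<close>

lemma normed_space_over_dual_scale:
  "normed_space_over (dual_scale :: 'k::real_normed_field \<Rightarrow> ('a::real_normed_vector \<Rightarrow>\<^sub>L 'k) \<Rightarrow> _)"
proof -
  have ap: "blinfun_apply (dual_scale c f) x = c * f x" for c and f :: "'a \<Rightarrow>\<^sub>L 'k" and x
    by (simp add: dual_scale_def)
  have le: "norm (dual_scale c f) \<le> norm c * norm f" for c and f :: "'a \<Rightarrow>\<^sub>L 'k"
  proof (rule norm_blinfun_bound)
    fix x
    have "norm (f x) \<le> norm f * norm x" by (rule norm_blinfun)
    then show "norm (dual_scale c f x) \<le> norm c * norm f * norm x"
      by (simp add: ap norm_mult mult.assoc mult_left_mono)
  qed simp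
  have "norm (dual_scale c f) = norm c * norm f" for c and f :: "'a \<Rightarrow>\<^sub>L 'k"
  proof (cases "c = 0")
    case True
    then show ?thesis using le[of c f] by simp
  next
    case False
    have "dual_scale (inverse c) (dual_scale c f) = f"
      using False by (intro blinfun_eqI) (simp add: ap)
    then have "norm c * norm f \<le> norm (dual_scale c f)"
      using le[of "inverse c" "dual_scale c f"] False
      by (simp add: norm_inverse norm_divide field_simps)
    then show ?thesis using le[of c f] by simp
  qed
  moreover have "vector_space (dual_scale :: 'k \<Rightarrow> ('a \<Rightarrow>\<^sub>L 'k) \<Rightarrow> _)"
    by unfold_locales
      (auto intro!: blinfun_eqI simp: ap blinfun.add_left blinfun.add_right algebra_simps)
  moreover have "dual_scale (of_real r) f = r *\<^sub>R f" for r and f :: "'a \<Rightarrow>\<^sub>L 'k"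
    by (intro blinfun_eqI) (simp add: ap blinfun.scaleR_left scaleR_conv_of_real)
  ultimately show ?thesis by (simp add: normed_space_over_def)
qed

lemma bounded_functional_on_UNIV_iff:
  "bounded_functional_on sc UNIV \<phi> \<longleftrightarrow>
     linear_form sc \<phi> \<and> (\<exists>K. \<forall>x. norm (\<phi> x) \<le> K * norm x)"
  by (auto simp: bounded_functional_on_def linear_form_def)

lemma linear_form_eval: "linear_form dual_scale (\<lambda>f. blinfun_apply f x)"
  by (simp add: linear_form_def dual_scale_def blinfun.add_left)

lemma linear_form_dual: "f \<in> dual sc \<Longrightarrow> linear_form sc (blinfun_apply f)"
  by (simp add: dual_def bounded_functional_on_UNIV_iff)

text \<open>
  Real linearity of a functional is automatic because \<open>sc\<close> extends the real scalar multiplication.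
\<close>

lemma dual_of_functional:
  assumes ns: "normed_space_over sc" and \<phi>: "linear_form sc \<phi>" "\<And>x. norm (\<phi> x) \<le> K * norm x"
  obtains f where "f \<in> dual sc" "\<And>x. blinfun_apply f x = \<phi> x"
proof -
  have "\<phi> (r *\<^sub>R x) = r *\<^sub>R \<phi> x" for r x
    using \<phi>(1) ns unfolding normed_space_over_def linear_form_def
    by (metis scaleR_conv_of_real)
  then have "bounded_linear \<phi>"
    using \<phi> by (intro bounded_linear_intro[of _ K]) (auto simp: linear_form_def mult.commute)
  then have ap: "blinfun_apply (Blinfun \<phi>) = \<phi>" by (rule bounded_linear_Blinfun_apply)
  show thesis
    by (rule that[of "Blinfun \<phi>"]) (use \<phi> in \<open>auto simp: ap dual_def bounded_functional_on_UNIV_iff\<close>)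
qed

text \<open>Hahn-Banach for the quotient seminorm, the distance to \<open>Y\<close>.\<close>

lemma separate_from_closed_subspace:
  fixes sc :: "'k::real_normed_field \<Rightarrow> 'a::real_normed_vector \<Rightarrow> 'a"
  assumes ns: "normed_space_over sc" and hb: "hahn_banach sc"
    and Y: "module.subspace sc Y" "closed Y" and v: "v \<notin> Y"
  obtains f where "f \<in> dual sc" "\<And>y. y \<in> Y \<Longrightarrow> blinfun_apply f y = 0" "blinfun_apply f v \<noteq> 0"
proof -
  interpret vector_space sc using ns by (simp add: normed_space_over_def)
  have nsc: "norm (sc c x) = norm c * norm x" for c x
    using ns by (simp add: normed_space_over_def)
  have Y0: "0 \<in> Y" and Yadd: "\<And>a b. a \<in> Y \<Longrightarrow> b \<in> Y \<Longrightarrow> a + b \<in> Y"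
    and Ysc: "\<And>c a. a \<in> Y \<Longrightarrow> sc c a \<in> Y"
    using Y(1) by (auto simp: subspace_0 subspace_add subspace_scale)
  define p where "p x = infdist x Y" for x
  have ple: "p x \<le> norm (x - a)" if "a \<in> Y" for x a
    unfolding p_def using infdist_le[OF that, of x] by (simp add: dist_norm)
  have pge: "c \<le> p x" if "\<And>a. a \<in> Y \<Longrightarrow> c \<le> norm (x - a)" for c x
    using Y0 that by (auto simp: p_def infdist_def dist_norm intro!: cINF_greatest)
  have "p (x + y) \<le> p x + p y" for x y
  proof -
    have *: "p (x + y) \<le> norm (x - a) + norm (y - b)" if "a \<in> Y" "b \<in> Y" for a b
    proof -
      have "p (x + y) \<le> norm ((x + y) - (a + b))" using that by (intro ple Yadd)
      also have "(x + y) - (a + b) = (x - a) + (y - b)" by simp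
      also have "norm \<dots> \<le> norm (x - a) + norm (y - b)" by (rule norm_triangle_ineq)
      finally show ?thesis .
    qed
    have "p (x + y) - norm (y - b) \<le> p x" if "b \<in> Y" for b
      by (rule pge) (use *[OF _ that] in \<open>simp add: algebra_simps\<close>)
    then have "p (x + y) - p x \<le> p y"
      by (intro pge) (simp add: algebra_simps)
    then show ?thesis by simp
  qed
  moreover have "p (sc c x) \<le> norm c * p x" for c x
  proof (cases "c = 0")
    case True
    then show ?thesis using ple[OF Y0, of 0] by simp
  next
    case False
    have "p (sc c x) / norm c \<le> p x"
    proof (rule pge)
      fix a assume "a \<in> Y"
      then have "p (sc c x) \<le> norm (sc c x - sc c a)" by (intro ple Ysc)
      also have "\<dots> = norm c * norm (x - a)" by (simp add: scale_right_diff_distrib[symmetric] nsc)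
      finally show "p (sc c x) / norm c \<le> norm (x - a)"
        using False by (simp add: field_simps)
    qed
    then show ?thesis using False by (simp add: field_simps)
  qed
  ultimately have "seminorm_over sc p" by (simp add: seminorm_over_def)
  moreover have "p v \<noteq> 0"
    using in_closed_iff_infdist_zero[OF Y(2), of v] Y0 v by (auto simp: p_def)
  ultimately obtain \<phi> where \<phi>: "linear_form sc \<phi>" "\<And>x. norm (\<phi> x) \<le> p x" "\<phi> v \<noteq> 0"
    using hb unfolding hahn_banach_def by meson
  have bd: "norm (\<phi> x) \<le> 1 * norm x" for x
    using \<phi>(2)[of x] ple[OF Y0, of x] by simp
  obtain f where f: "f \<in> dual sc" "\<And>x. blinfun_apply f x = \<phi> x"
    using dual_of_functional[OF ns \<phi>(1) bd] by blast
  show thesis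
  proof (rule that[OF f(1)])
    fix y assume "y \<in> Y"
    then have "norm (\<phi> y) \<le> 0" using order_trans[OF \<phi>(2) ple[of y y]] by simp
    then show "blinfun_apply f y = 0" by (simp add: f(2))
  qed (use \<phi>(3) in \<open>simp add: f(2)\<close>)
qed

section \<open>From an invariant subspace to compatible sequences\<close>

lemma no_weakly_null_subseq_const:
  assumes "bounded_functional_on sc S \<phi>" "\<phi> v \<noteq> 0" "\<phi> 0 = 0"
  shows "no_weakly_null_subseq_on sc S (\<lambda>n. v)"
proof -
  have "\<not> (\<lambda>n::nat. \<phi> v) \<longlonglongrightarrow> 0" using assms(2) by (simp add: LIMSEQ_const_iff)
  then show ?thesis
    using assms(1,3) by (auto simp: no_weakly_null_subseq_on_def weakly_tendsto_on_def o_def)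
qed

lemma compatible_of_invariant_subspace:
  fixes sc :: "'k::real_normed_field \<Rightarrow> 'a::real_normed_vector \<Rightarrow> 'a"
  assumes ns: "normed_space_over sc" and hb: "hahn_banach sc"
    and Y: "has_nontrivial_invariant_subspace sc T"
  shows "\<exists>(x :: nat \<Rightarrow> 'a) (xs :: nat \<Rightarrow> 'a \<Rightarrow>\<^sub>L 'k). compatible sc T x xs"
proof -
  interpret vector_space sc using ns by (simp add: normed_space_over_def)
  obtain Y where Y: "subspace Y" "closed Y" "T ` Y \<subseteq> Y" "{0} \<subset> Y" "Y \<subset> UNIV"
    using Y by (auto simp: has_nontrivial_invariant_subspace_def invariant_subspace_def)
  obtain y where y: "y \<in> Y" "y \<noteq> 0" using Y(4) by blast
  obtain z where "z \<notin> Y" using Y(5) by blast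
  then obtain f where f: "f \<in> dual sc" "\<And>y. y \<in> Y \<Longrightarrow> blinfun_apply f y = 0" "blinfun_apply f z \<noteq> 0"
    using separate_from_closed_subspace[OF ns hb Y(1,2)] by blast
  have "y \<notin> {0}" using y(2) by simp
  then obtain g where g: "g \<in> dual sc" "blinfun_apply g y \<noteq> 0"
    using separate_from_closed_subspace[OF ns hb subspace_single_0 closed_singleton] by blast
  have TY: "(T ^^ k) y \<in> Y" for k
    by (induction k) (use y Y(3) in auto)
  have "no_weakly_null_subseq_on sc UNIV (\<lambda>n. y)"
    by (rule no_weakly_null_subseq_const[of _ _ "blinfun_apply g"])
      (use g in \<open>auto simp: dual_def\<close>)
  moreover have "no_weakly_null_subseq_on dual_scale (dual sc) (\<lambda>n. f)"
  proof (rule no_weakly_null_subseq_const[of _ _ "\<lambda>h. blinfun_apply h z"])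
    have "norm (blinfun_apply h z) \<le> norm z * norm h" for h :: "'a \<Rightarrow>\<^sub>L 'k"
      using norm_blinfun[of h z] by (simp add: mult.commute)
    then show "bounded_functional_on dual_scale (dual sc) (\<lambda>h. blinfun_apply h z)"
      using linear_form_eval[of z] unfolding bounded_functional_on_def linear_form_def by blast
  qed (use f in auto)
  moreover have "(\<lambda>n. 1 / real n) \<longlonglongrightarrow> 0" by (rule lim_1_over_n)
  ultimately have "compatible sc T (\<lambda>n. y) (\<lambda>n. f)"
    unfolding compatible_def using f(1,2) TY
    by (intro conjI exI[of _ "\<lambda>n. 1 / real n"]) (auto simp: image_constant_conv)
  then show ?thesis by blast
qed

section \<open>From compatible sequences to an invariant subspace\<close>

lemma bounded_image_atLeast_1:
  assumes "bounded ((x :: nat \<Rightarrow> 'v::real_normed_vector) ` {1..})"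
  obtains K where "\<And>n. norm (x n) \<le> K"
proof -
  have "(UNIV :: nat set) = insert 0 {1..}" by auto
  then have "range x = insert (x 0) (x ` {1..})" by (metis image_insert)
  then have "bounded (range x)" using assms by simp
  then show thesis using that by (auto simp: bounded_iff)
qed

text \<open>
  The sequence is a subsequence of itself; with indices starting at 1 it is the one given by
  \<open>Suc\<close>.
\<close>

lemma not_weakly_null:
  assumes "no_weakly_null_subseq_on sc S x"
  obtains \<phi> where "bounded_functional_on sc S \<phi>" "\<not> (\<lambda>n. \<phi> (x n)) \<longlonglongrightarrow> \<phi> 0"
proof -
  have "\<not> weakly_tendsto_on sc S (x \<circ> Suc) 0"
    using assms by (auto simp: no_weakly_null_subseq_on_def strict_mono_Suc_iff)
  then obtain \<phi> where \<phi>: "bounded_functional_on sc S \<phi>" "\<not> (\<lambda>n. \<phi> (x (Suc n))) \<longlonglongrightarrow> \<phi> 0"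
    by (auto simp: weakly_tendsto_on_def)
  then show thesis using that LIMSEQ_Suc[of "\<lambda>n. \<phi> (x n)"] by blast
qed

lemma generalized_weak_limit:
  fixes sc :: "'k::real_normed_field \<Rightarrow> 'a::real_normed_vector \<Rightarrow> 'a"
  assumes ns: "normed_space_over sc"
    and hb: "hahn_banach (dual_scale :: 'k \<Rightarrow> ('a \<Rightarrow>\<^sub>L 'k) \<Rightarrow> _)"
    and refl: "reflexive sc" and bd: "bounded (x ` {1..})"
    and x: "no_weakly_null_subseq_on sc UNIV x"
  obtains x0 where "x0 \<noteq> 0"
    "\<And>h. h \<in> dual sc \<Longrightarrow> (\<lambda>n. blinfun_apply h (x n)) \<longlonglongrightarrow> 0 \<Longrightarrow> blinfun_apply h x0 = 0"
proof -
  obtain K where K: "\<And>n. norm (x n) \<le> K" using bounded_image_atLeast_1[OF bd] by blast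
  obtain \<gamma> where \<gamma>: "bounded_functional_on sc UNIV \<gamma>" "\<not> (\<lambda>n. \<gamma> (x n)) \<longlonglongrightarrow> \<gamma> 0"
    using not_weakly_null[OF x] by blast
  then obtain M where M: "linear_form sc \<gamma>" "\<And>x. norm (\<gamma> x) \<le> M * norm x"
    by (auto simp: bounded_functional_on_UNIV_iff)
  obtain g where g: "g \<in> dual sc" "\<And>x. blinfun_apply g x = \<gamma> x"
    using dual_of_functional[OF ns M] by blast
  have g0: "\<not> (\<lambda>n. blinfun_apply g (x n)) \<longlonglongrightarrow> 0"
    using \<gamma>(2) g(2)[of 0] by (simp add: g(2))
  have bdd: "norm (blinfun_apply h (x n)) \<le> K * norm h" for n and h :: "'a \<Rightarrow>\<^sub>L 'k"
    using norm_blinfun[of h "x n"] mult_left_mono[OF K[of n], of "norm h"]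
    by (simp add: mult.commute)
  obtain \<phi> where \<phi>: "linear_form dual_scale \<phi>" "\<And>h. norm (\<phi> h) \<le> K * norm h" "\<phi> g \<noteq> 0"
      "\<And>h. (\<lambda>n. blinfun_apply h (x n)) \<longlonglongrightarrow> 0 \<Longrightarrow> \<phi> h = 0"
    using generalized_limit[where A = "\<lambda>n h. blinfun_apply h (x n)", OF hb linear_form_eval bdd g0]
    by blast
  have "bounded_functional_on dual_scale (dual sc) \<phi>"
    using \<phi>(1,2) by (auto simp: bounded_functional_on_def linear_form_def)
  then obtain x0 where x0: "\<And>h. h \<in> dual sc \<Longrightarrow> \<phi> h = blinfun_apply h x0"
    using refl unfolding reflexive_def by blast
  show thesis
  proof (rule that)
    show "x0 \<noteq> 0" using x0[OF g(1)] \<phi>(3) by auto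
  qed (use x0 \<phi>(4) in metis)
qed

text \<open>Reflexivity makes weak convergence in the dual the same as pointwise convergence.\<close>

lemma generalized_dual_limit:
  fixes sc :: "'k::real_normed_field \<Rightarrow> 'a::real_normed_vector \<Rightarrow> 'a"
  assumes ns: "normed_space_over sc" and hb: "hahn_banach sc"
    and refl: "reflexive sc" and xs: "xs ` {1..} \<subseteq> dual sc" and bd: "bounded (xs ` {1..})"
    and null: "no_weakly_null_subseq_on dual_scale (dual sc) xs"
  obtains f where "f \<in> dual sc" "f \<noteq> 0"
    "\<And>z. (\<lambda>n. blinfun_apply (xs n) z) \<longlonglongrightarrow> 0 \<Longrightarrow> blinfun_apply f z = 0"
proof -
  obtain K where K: "\<And>n. norm (xs n) \<le> K" using bounded_image_atLeast_1[OF bd] by blast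
  obtain \<Phi> where \<Phi>: "bounded_functional_on dual_scale (dual sc) \<Phi>" "\<not> (\<lambda>n. \<Phi> (xs n)) \<longlonglongrightarrow> \<Phi> 0"
    using not_weakly_null[OF null] by blast
  then obtain z where z: "\<And>h. h \<in> dual sc \<Longrightarrow> \<Phi> h = blinfun_apply h z"
    using refl unfolding reflexive_def by blast
  have xs': "xs (Suc n) \<in> dual sc" for n using xs by auto
  have "0 \<in> dual sc"
    by (auto simp: dual_def bounded_functional_on_UNIV_iff linear_form_def intro!: exI[of _ 0])
  then have "\<not> (\<lambda>n. blinfun_apply (xs (Suc n)) z) \<longlonglongrightarrow> 0"
    using \<Phi>(2) z xs' LIMSEQ_imp_Suc[of "\<lambda>n. \<Phi> (xs n)"] by auto
  moreover have "norm (blinfun_apply (xs (Suc n)) w) \<le> K * norm w" for n w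
    using norm_blinfun[of "xs (Suc n)" w] mult_right_mono[OF K[of "Suc n"], of "norm w"] by simp
  ultimately obtain \<phi> where \<phi>: "linear_form sc \<phi>" "\<And>w. norm (\<phi> w) \<le> K * norm w" "\<phi> z \<noteq> 0"
      "\<And>w. (\<lambda>n. blinfun_apply (xs (Suc n)) w) \<longlonglongrightarrow> 0 \<Longrightarrow> \<phi> w = 0"
    using generalized_limit[where A = "\<lambda>n. blinfun_apply (xs (Suc n))" and K = K and v = z,
        OF hb linear_form_dual[OF xs']] by blast
  obtain f where f: "f \<in> dual sc" "\<And>x. blinfun_apply f x = \<phi> x"
    using dual_of_functional[OF ns \<phi>(1,2)] by blast
  show thesis
  proof (rule that[OF f(1)])
    show "f \<noteq> 0" using f(2)[of z] \<phi>(3) by auto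
    show "blinfun_apply f w = 0" if "(\<lambda>n. blinfun_apply (xs n) w) \<longlonglongrightarrow> 0" for w
      using LIMSEQ_Suc[OF that] \<phi>(4) f(2) by simp
  qed
qed

lemma dim_gt_one_kernel:
  assumes vs: "vector_space sc" and dim: "dim_gt_one sc" and f: "linear_form sc f"
  obtains v where "v \<noteq> 0" "f v = 0"
proof -
  interpret vector_space sc by (rule vs)
  obtain B where B: "independent B" "infinite B \<or> 1 < card B"
    using dim by (auto simp: dim_gt_one_def)
  then have "\<not> (\<exists>a. B \<subseteq> {a})"
    by (metis card_mono card.empty card_insert_disjoint finite.intros finite_subset
        insert_absorb One_nat_def linorder_not_less card_1_singleton_iff)
  then obtain a b where ab: "a \<in> B" "b \<in> B" "a \<noteq> b"
    by blast
  define v where "v = sc (f b) a + sc (- f a) b"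
  have fv: "f v = 0"
    using f unfolding v_def linear_form_def by (simp del: scale_minus_left)
  have a0: "a \<noteq> 0" using ab(1) B(1) dependent_zero by blast
  show thesis
  proof (cases "v = 0")
    case False
    then show thesis using that fv by blast
  next
    case True
    have "independent {b, a}" using B(1) by (rule independent_mono) (use ab in auto)
    then have "b \<notin> span {a}" using ab(3) by (simp add: independent_insert)
    have "f a = 0"
    proof (rule ccontr)
      assume fa: "f a \<noteq> 0"
      have "sc (f a) b = sc (f b) a" using True by (simp add: v_def)
      then have "sc (inverse (f a)) (sc (f a) b) = sc (inverse (f a) * f b) a"
        by simp
      then have "b = sc (inverse (f a) * f b) a" using fa by simp
      moreover have "sc (inverse (f a) * f b) a \<in> span {a}"
        by (intro span_scale span_base) simp
      ultimately show False using \<open>b \<notin> span {a}\<close> by metis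
    qed
    then show thesis using that a0 by blast
  qed
qed

lemma invariant_subspace_of_compatible:
  fixes sc :: "'k::real_normed_field \<Rightarrow> 'a::real_normed_vector \<Rightarrow> 'a"
  assumes ns: "normed_space_over sc" and hb: "hahn_banach sc"
    and hbd: "hahn_banach (dual_scale :: 'k \<Rightarrow> ('a \<Rightarrow>\<^sub>L 'k) \<Rightarrow> _)"
    and refl: "reflexive sc" and dim: "dim_gt_one sc" and T: "bounded_linear_over sc T"
    and comp: "compatible sc T x xs"
  shows "has_nontrivial_invariant_subspace sc T"
proof -
  interpret vector_space sc using ns by (simp add: normed_space_over_def)
  obtain \<epsilon> where \<epsilon>: "\<epsilon> \<longlonglongrightarrow> 0"
    "\<And>k l m. 1 \<le> k \<Longrightarrow> k \<le> l \<Longrightarrow> l \<le> m \<Longrightarrow> norm (blinfun_apply (xs m) ((T ^^ k) (x l))) < \<epsilon> m"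
    using comp unfolding compatible_def by blast
  obtain x0 where x0: "x0 \<noteq> 0"
    "\<And>h. h \<in> dual sc \<Longrightarrow> (\<lambda>n. blinfun_apply h (x n)) \<longlonglongrightarrow> 0 \<Longrightarrow> blinfun_apply h x0 = 0"
    using generalized_weak_limit[OF ns hbd refl, of x] comp by (auto simp: compatible_def)
  obtain f where f: "f \<in> dual sc" "f \<noteq> 0"
    "\<And>z. (\<lambda>n. blinfun_apply (xs n) z) \<longlonglongrightarrow> 0 \<Longrightarrow> blinfun_apply f z = 0"
    using generalized_dual_limit[OF ns hb refl, of xs] comp by (auto simp: compatible_def)
  have Tb: "bounded_linear T" and Tsc: "\<And>c x. T (sc c x) = sc c (T x)"
    using T by (auto simp: bounded_linear_over_def)
  have Tadd: "\<And>x y. T (x + y) = T x + T y" and T0: "T 0 = 0"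
    using Tb by (auto simp: linear_simps)
  have fadd: "f (y + z) = f y + f z" and fsc: "f (sc c y) = c * f y" for y z c
    using linear_form_dual[OF f(1)] by (auto simp: linear_form_def)
  have Pb: "bounded_linear (T ^^ k)" for k
    by (induction k) (use Tb in \<open>auto simp: id_def o_def intro: bounded_linear_compose\<close>)
  have Psc: "(T ^^ k) (sc c y) = sc c ((T ^^ k) y)" for k c y
    by (induction k) (auto simp: Tsc)
  define h where "h k = Blinfun (\<lambda>y. blinfun_apply f ((T ^^ k) y))" for k
  have hb': "bounded_linear (\<lambda>y. blinfun_apply f ((T ^^ k) y))" for k
    by (rule bounded_linear_compose[OF blinfun.bounded_linear_right Pb])
  have h: "blinfun_apply (h k) y = f ((T ^^ k) y)" for k y
    unfolding h_def by (simp add: bounded_linear_Blinfun_apply[OF hb'])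
  have hdual: "h k \<in> dual sc" for k
  proof -
    have "linear_form sc (h k)"
      by (simp add: linear_form_def blinfun.add_right) (simp add: h Psc fsc)
    then show ?thesis
      using norm_blinfun[of "h k"] by (auto simp: dual_def bounded_functional_on_UNIV_iff)
  qed
  have fx: "f ((T ^^ k) (x l)) = 0" if kl: "1 \<le> k" "k \<le> l" for k l
  proof (rule f(3))
    have "\<forall>\<^sub>F m in sequentially. norm (blinfun_apply (xs m) ((T ^^ k) (x l))) \<le> \<epsilon> m"
      using eventually_ge_at_top[of l] by eventually_elim (use \<epsilon>(2)[OF kl] in \<open>auto intro: less_imp_le\<close>)
    then show "(\<lambda>m. blinfun_apply (xs m) ((T ^^ k) (x l))) \<longlonglongrightarrow> 0"
      by (rule Lim_null_comparison[OF _ \<epsilon>(1)])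
  qed
  have fx0: "f ((T ^^ k) x0) = 0" if k: "1 \<le> k" for k
  proof -
    have "\<forall>\<^sub>F l in sequentially. blinfun_apply (h k) (x l) = 0"
      using eventually_ge_at_top[of k] by eventually_elim (use fx[OF k] in \<open>simp add: h\<close>)
    then have "(\<lambda>l. blinfun_apply (h k) (x l)) \<longlonglongrightarrow> 0"
      by (rule tendsto_eventually)
    then show ?thesis using x0(2)[OF hdual, of k] by (simp add: h)
  qed
  obtain z where z: "f z \<noteq> 0" using f(2) blinfun_eqI[of f 0] by auto
  have nontriv: ?thesis if "subspace Y" "closed Y" "T ` Y \<subseteq> Y" "a \<in> Y" "a \<noteq> 0" "b \<notin> Y" for Y a b
  proof -
    have "{0} \<subset> Y" using that subspace_0[OF that(1)] by auto
    moreover have "Y \<subset> UNIV" using that by auto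
    ultimately show ?thesis using that(1-3)
      unfolding has_nontrivial_invariant_subspace_def invariant_subspace_def by blast
  qed
  \<comment> \<open>The case distinction is forced by \<open>k \<ge> 1\<close>: nothing is known about \<open>f x0\<close>.\<close>
  consider "T x0 \<noteq> 0" | "T x0 = 0" "\<exists>b. T b \<noteq> 0" | "\<And>y. T y = 0" by blast
  then show ?thesis
  proof cases
    case 1
    define Y where "Y = (\<Inter>k. {y. blinfun_apply (h k) y = 0})"
    show ?thesis
    proof (rule nontriv)
      show "subspace Y"
        using linear_form_dual[OF hdual] unfolding Y_def linear_form_def
        by (intro subspace_Inter) (auto intro!: subspaceI)
      show "closed Y"
        unfolding Y_def by (intro closed_INT ballI closed_Collect_eq continuous_intros)
      show "T ` Y \<subseteq> Y"
      proof clarify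
        fix y assume "y \<in> Y"
        then have "h (Suc k) y = 0" for k by (simp add: Y_def)
        then show "T y \<in> Y" by (simp add: Y_def h funpow_swap1)
      qed
      show "T x0 \<in> Y"
        using fx0[of "Suc _"] by (simp add: Y_def h funpow_swap1)
      show "z \<notin> Y"
      proof
        assume "z \<in> Y"
        then have "h 0 z = 0" by (simp add: Y_def)
        then show False using z by (simp add: h)
      qed
    qed (rule 1)
  next
    case 2
    then obtain b where b: "T b \<noteq> 0" by blast
    show ?thesis
    proof (rule nontriv)
      show "subspace {y. T y = 0}" by (rule subspaceI) (auto simp: Tadd Tsc T0)
      show "closed {y. T y = 0}"
        by (intro closed_Collect_eq linear_continuous_on[OF Tb] continuous_intros)
      show "T ` {y. T y = 0} \<subseteq> {y. T y = 0}" by (auto simp: T0)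
      show "x0 \<in> {y. T y = 0}" using 2 by simp
      show "b \<notin> {y. T y = 0}" using b by simp
    qed (rule x0(1))
  next
    case 3
    obtain v where v: "v \<noteq> 0" "f v = 0"
      using dim_gt_one_kernel[OF vector_space_axioms dim linear_form_dual[OF f(1)]] by blast
    show ?thesis
    proof (rule nontriv)
      show "subspace {y. f y = 0}" by (rule subspaceI) (auto simp: fadd fsc)
      show "closed {y. f y = 0}" by (intro closed_Collect_eq continuous_intros)
      show "T ` {y. f y = 0} \<subseteq> {y. f y = 0}" by (auto simp: 3)
      show "v \<in> {y. f y = 0}" using v by simp
      show "z \<notin> {y. f y = 0}" using z by simp
    qed (rule v(1))
  qed
qed

section \<open>The characterization\<close>

lemma invariant_subspace_iff_compatible:
  fixes sc :: "'k::real_normed_field \<Rightarrow> 'a::real_normed_vector \<Rightarrow> 'a"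
  assumes "normed_space_over sc" "hahn_banach sc"
    and "hahn_banach (dual_scale :: 'k \<Rightarrow> ('a \<Rightarrow>\<^sub>L 'k) \<Rightarrow> _)"
    and "reflexive sc" "dim_gt_one sc" "bounded_linear_over sc T"
  shows "has_nontrivial_invariant_subspace sc T \<longleftrightarrow>
    (\<exists>(x :: nat \<Rightarrow> 'a) (xs :: nat \<Rightarrow> 'a \<Rightarrow>\<^sub>L 'k). compatible sc T x xs)"
  using compatible_of_invariant_subspace[OF assms(1,2)]
    invariant_subspace_of_compatible[OF assms] by blast

lemma hahn_banach_normed_space_over_complex:
  fixes sc :: "complex \<Rightarrow> 'v::real_normed_vector \<Rightarrow> 'v"
  shows "normed_space_over sc \<Longrightarrow> hahn_banach sc"
  by (rule hahn_banach_complex) (auto simp: normed_space_over_def)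

theorem mainTheorem1:
  fixes T :: "'a::banach \<Rightarrow> 'a"
    and scaleC :: "complex \<Rightarrow> 'b::banach \<Rightarrow> 'b" and U :: "'b \<Rightarrow> 'b"
  shows
    "(reflexive ((*\<^sub>R) :: real \<Rightarrow> 'a \<Rightarrow> 'a) \<and>
      dim_gt_one ((*\<^sub>R) :: real \<Rightarrow> 'a \<Rightarrow> 'a) \<and>
      bounded_linear_over ((*\<^sub>R) :: real \<Rightarrow> 'a \<Rightarrow> 'a) T \<longrightarrow>
        (has_nontrivial_invariant_subspace ((*\<^sub>R) :: real \<Rightarrow> 'a \<Rightarrow> 'a) T \<longleftrightarrow>
          (\<exists>(x :: nat \<Rightarrow> 'a) (xs :: nat \<Rightarrow> 'a \<Rightarrow>\<^sub>L real). compatible (*\<^sub>R) T x xs)))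
     \<and>
     (normed_space_over scaleC \<and>
      reflexive scaleC \<and>
      dim_gt_one scaleC \<and>
      bounded_linear_over scaleC U \<longrightarrow>
        (has_nontrivial_invariant_subspace scaleC U \<longleftrightarrow>
          (\<exists>(x :: nat \<Rightarrow> 'b) (xs :: nat \<Rightarrow> 'b \<Rightarrow>\<^sub>L complex). compatible scaleC U x xs)))"
proof (intro conjI impI; elim conjE)
  assume "reflexive ((*\<^sub>R) :: real \<Rightarrow> 'a \<Rightarrow> 'a)" "dim_gt_one ((*\<^sub>R) :: real \<Rightarrow> 'a \<Rightarrow> 'a)"
    "bounded_linear_over ((*\<^sub>R) :: real \<Rightarrow> 'a \<Rightarrow> 'a) T"
  moreover have "hahn_banach (dual_scale :: real \<Rightarrow> ('a \<Rightarrow>\<^sub>L real) \<Rightarrow> _)"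
    by (simp add: dual_scale_real hahn_banach_real)
  ultimately show "has_nontrivial_invariant_subspace ((*\<^sub>R) :: real \<Rightarrow> 'a \<Rightarrow> 'a) T \<longleftrightarrow>
      (\<exists>(x :: nat \<Rightarrow> 'a) (xs :: nat \<Rightarrow> 'a \<Rightarrow>\<^sub>L real). compatible (*\<^sub>R) T x xs)"
    by (intro invariant_subspace_iff_compatible hahn_banach_real)
      (simp_all add: normed_space_over_real)
next
  assume "normed_space_over scaleC" "reflexive scaleC" "dim_gt_one scaleC"
    "bounded_linear_over scaleC U"
  then show "has_nontrivial_invariant_subspace scaleC U \<longleftrightarrow>
      (\<exists>(x :: nat \<Rightarrow> 'b) (xs :: nat \<Rightarrow> 'b \<Rightarrow>\<^sub>L complex). compatible scaleC U x xs)"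
    by (intro invariant_subspace_iff_compatible hahn_banach_normed_space_over_complex
        normed_space_over_dual_scale)
qed

end
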